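(* Let $d\ge 2$ and $N\in\mathbb{N}$, and let $\{\Omega_1,\ldots,\Omega_N\}$ be an equal measure partition of $[0,1]^d$ with diameter constants $c_1(d),c_2(d)$, i.e. $c_1(d)N^{-1/d}\le \operatorname{diam}\Omega_j\le c_2(d)N^{-1/d}$ for $1\le j\le N$. Let $Y_1,\ldots,Y_N$ be independent random points such that $Y_j$ is uniformly distributed in $\Omega_j$ for $1\le j\le N$. Then $$\mathbb{E}\Big[\sup_{f\in\mathcal{H}^{\mathbf 1}(K),\ \|f\|_{\mathcal{H}^{\mathbf 1}(K)}\le 1}\Big|\frac1N\sum_{n=1}^N f(Y_n)-\int_{[0,1]^d}f(x)\,dx\Big|^2\Big]\le \frac{d\cdot c_2(d)}{N^{1+\frac1d}}.$$
   Context: Equal measure partition: measurable sets $\Omega_1,\ldots,\Omega_N$ that are pairwise disjoint with union $[0,1]^d$, with Lebesgue measure $\lambda(\Omega_j)=1/N$ for every $j$, and with $c_1(d)N^{-1/d}\le\operatorname{diam}\Omega_j\le c_2(d)N^{-1/d}$ for all $1\le j\le N$, where $\operatorname{diam}$ is the Euclidean diameter and $c_1(d),c_2(d)$ are positive constants depending only on $d$. The space $\mathcal{H}^{\mathbf 1}(K)$: the Sobolev space $\mathcal{H}^{\mathbf 1}=\mathcal{H}^{(1,\ldots,1)}([0,1]^d)$ of real functions equipped with the reproducing kernel $$K(x,y)=\int_{[0,1]^d}\mathbf 1_{(x,1]}(t)\,\mathbf 1_{(y,1]}(t)\,dt,\qquad x,y\in[0,1]^d,$$ where $(x,1]=\prod_{i=1}^d(x_i,1]$;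 that is, $\mathcal{H}^{\mathbf 1}(K)$ is the reproducing kernel Hilbert space on $[0,1]^d$ with kernel $K$. Its inner product is $$\langle f,g\rangle_{\mathcal{H}^{\mathbf 1}(K)}=\int_{[0,1]^d}\frac{\partial^d f}{\partial x}(t)\,\frac{\partial^d g}{\partial x}(t)\,dt,\qquad \partial x=\partial x_1\partial x_2\cdots\partial x_d,$$ with norm $\|f\|_{\mathcal{H}^{\mathbf 1}(K)}=\langle f,f\rangle_{\mathcal{H}^{\mathbf 1}(K)}^{1/2}$, and $f(y)=\langle f,K(\cdot,y)\rangle_{\mathcal{H}^{\mathbf 1}(K)}$ for all $f\in\mathcal{H}^{\mathbf 1}(K)$ and $y\in[0,1]^d$. *)

theory Defs
  imports "HOL-Analysis.Analysis" "HOL-Probability.Probability"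
begin

(* Reproducing kernel Hilbert space on X: H is the underlying set of real functions on X, ip the
   inner product, and K the kernel.  A function on X is represented by its extension by 0 to the
   whole type, so that equality in H is equality on X.  For given X and K there is at most one such
   space (Aronszajn), so "rkhs X K H ip" says that (H, ip) is the reproducing kernel Hilbert space
   with kernel K. *)
locale rkhs =
  fixes X :: "'a set" and K :: "'a \<Rightarrow> 'a \<Rightarrow> real"
    and H :: "('a \<Rightarrow> real) set" and ip :: "('a \<Rightarrow> real) \<Rightarrow> ('a \<Rightarrow> real) \<Rightarrow> real"
  assumes vanishes_outside: "\<lbrakk>f \<in> H; x \<notin> X\<rbrakk> \<Longrightarrow> f x = 0"
    and zero_mem: "(\<lambda>x. 0) \<in> H"
    and add_mem: "\<lbrakk>f \<in> H; g \<in> H\<rbrakk> \<Longrightarrow> (\<lambda>x. f x + g x) \<in> H"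
    and scale_mem: "f \<in> H \<Longrightarrow> (\<lambda>x. c * f x) \<in> H"
    and ip_commute: "\<lbrakk>f \<in> H; g \<in> H\<rbrakk> \<Longrightarrow> ip f g = ip g f"
    and ip_add: "\<lbrakk>f \<in> H; g \<in> H; h \<in> H\<rbrakk> \<Longrightarrow> ip (\<lambda>x. f x + g x) h = ip f h + ip g h"
    and ip_scale: "\<lbrakk>f \<in> H; h \<in> H\<rbrakk> \<Longrightarrow> ip (\<lambda>x. c * f x) h = c * ip f h"
    and ip_nonneg: "f \<in> H \<Longrightarrow> 0 \<le> ip f f"
    and ip_definite: "\<lbrakk>f \<in> H; ip f f = 0\<rbrakk> \<Longrightarrow> f = (\<lambda>x. 0)"
    and complete: "\<lbrakk>\<And>n. u n \<in> H;
        \<And>e. e > 0 \<Longrightarrow> \<exists>n0. \<forall>m\<ge>n0. \<forall>n\<ge>n0.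
          sqrt (ip (\<lambda>x. u m x - u n x) (\<lambda>x. u m x - u n x)) < e\<rbrakk>
        \<Longrightarrow> \<exists>f\<in>H. (\<lambda>n. sqrt (ip (\<lambda>x. u n x - f x) (\<lambda>x. u n x - f x))) \<longlonglongrightarrow> 0"
    and kernel_mem: "y \<in> X \<Longrightarrow> (\<lambda>x. if x \<in> X then K x y else 0) \<in> H"
    and reproducing: "\<lbrakk>f \<in> H; y \<in> X\<rbrakk> \<Longrightarrow> f y = ip f (\<lambda>x. if x \<in> X then K x y else 0)"

(* (x,1], the product of the half-open intervals (x_i,1] *)
definition upper_box :: "real ^ 'n \<Rightarrow> (real ^ 'n) set" where
  "upper_box x = {t. \<forall>i. x $ i < t $ i \<and> t $ i \<le> 1}"

(* The reproducing kernel Hilbert space on [0,1]^d with this kernel consists of the functions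
   f(x) = integral of g over (x,1] with g square integrable on [0,1]^d, i.e. g = (-1)^d d^d f/dx
   almost everywhere, and its inner product is the L2 inner product of the mixed derivatives. *)
definition box_kernel :: "real ^ 'n \<Rightarrow> real ^ 'n \<Rightarrow> real" where
  "box_kernel x y =
    (LINT t:cbox 0 1|lborel. indicator (upper_box x) t * indicator (upper_box y) t)"

definition equal_measure_partition ::
    "real \<Rightarrow> real \<Rightarrow> nat \<Rightarrow> (nat \<Rightarrow> (real ^ 'n) set) \<Rightarrow> bool" where
  "equal_measure_partition c1 c2 N \<Omega> \<longleftrightarrow>
    (\<forall>j\<in>{1..N}. \<Omega> j \<in> sets lebesgue \<and> measure lebesgue (\<Omega> j) = 1 / real N \<and>
      c1 * real N powr (- 1 / real CARD('n)) \<le> diameter (\<Omega> j) \<and>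
      diameter (\<Omega> j) \<le> c2 * real N powr (- 1 / real CARD('n))) \<and>
    disjoint_family_on \<Omega> {1..N} \<and> (\<Union>j\<in>{1..N}. \<Omega> j) = cbox 0 1"

(* Y is a Borel random vector, whereas A need only be Lebesgue measurable; hence the uniform
   distribution on A is transported to the Borel sets along the identity. *)
definition uniformly_distributed_in :: "'w measure \<Rightarrow> ('w \<Rightarrow> real ^ 'n) \<Rightarrow> (real ^ 'n) set \<Rightarrow> bool" where
  "uniformly_distributed_in M Y A \<longleftrightarrow>
    Y \<in> borel_measurable M \<and> distr M borel Y = distr (uniform_measure lebesgue A) borel (\<lambda>x. x)"

end

theory Submission
  imports Defs
begin

text \<open>
  Let \<open>Y'\<close> be an independent copy of \<open>Y\<close>. Since the \<open>\<Omega> j\<close> have equal measure, the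
  quadrature error of \<open>f\<close> is the conditional expectation, given \<open>Y\<close>, of
  \<open>1/N \<Sum>n. f (Y n) - f (Y' n)\<close>. By Jensen's inequality and Cauchy-Schwarz in the reproducing kernel
  Hilbert space, its square is at most the conditional expectation of the squared norm of
  \<open>1/N \<Sum>n. K(\<cdot>, Y n) - K(\<cdot>, Y' n)\<close>, whatever \<open>f\<close> in the unit ball. In the full expectation the
  cross terms of this squared norm vanish by independence, and each diagonal term is at most
  \<open>d\<close> times the diameter of its cell, because \<open>K(x,y)\<close> is the product of the
  \<open>1 - max x\<^sub>i y\<^sub>i\<close>. The symmetrisation loses a factor 2, which the bound can afford.
\<close>

section \<open>The box kernel: product formula and distance estimate\<close>

lemma box_kernel_eq_prod:
  fixes x y :: "real ^ 'n"
  assumes "x \<in> cbox 0 1" "y \<in> cbox 0 1"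
  shows "box_kernel x y = (\<Prod>i\<in>UNIV. 1 - max (x $ i) (y $ i))"
proof -
  \<comment> \<open>Two upper boxes intersect in the upper box of the componentwise maximum of their
    corners, so the kernel is the volume of \<open>upper_box z\<close>.\<close>
  define z :: "real ^ 'n" where "z = (\<chi> i. max (x $ i) (y $ i))"
  have z: "0 \<le> z $ i" "z $ i \<le> 1" for i
    using assms by (auto simp: z_def mem_box_cart le_max_iff_disj)
  \<comment> \<open>The half-open box is squeezed between an open and a closed box of the same
    volume, which determines its own volume.\<close>
  have sub: "box z 1 \<subseteq> upper_box z" "upper_box z \<subseteq> cbox z 1"
    by (auto simp: upper_box_def mem_box_cart less_imp_le)
  have meas: "upper_box z \<in> sets borel"
    unfolding upper_box_def by measurable
  have ne: "cbox z 1 \<noteq> {}"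
    using z by (auto simp: interval_ne_empty_cart)
  have z1: "z \<bullet> b \<le> 1 \<bullet> b" if "b \<in> Basis" for b
    using z that by (auto simp: Basis_vec_def cart_eq_inner_axis[symmetric] inner_axis)
  have "measure lborel (upper_box z) \<le> measure lborel (cbox z 1)"
    using sub meas by (intro measure_mono_fmeasurable) (auto simp: fmeasurable_def emeasure_lborel_cbox_finite[unfolded infinity_ennreal_def])
  moreover have "measure lborel (box z 1) \<le> measure lborel (upper_box z)"
    using sub meas le_less_trans[OF emeasure_mono[OF sub(2), of lborel] emeasure_lborel_cbox_finite]
    by (intro measure_mono_fmeasurable) (auto simp: fmeasurable_def)
  moreover have "measure lborel (box z 1) = measure lborel (cbox z 1)"
    using z1 by (simp add: measure_lborel_box_eq measure_lborel_cbox_eq)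
  ultimately have m: "measure lborel (upper_box z) = (\<Prod>i\<in>UNIV. 1 - z $ i)"
    using ne by (simp add: content_cbox_cart)
  have "indicator (cbox 0 1) t *\<^sub>R (indicator (upper_box x) t * indicator (upper_box y) t)
      = (indicator (upper_box z) t :: real)" for t
  proof -
    have "t \<in> cbox 0 1" if "t \<in> upper_box z"
      using that z(1) by (force simp: upper_box_def mem_box_cart intro: order_trans less_imp_le)
    moreover have "t \<in> upper_box z \<longleftrightarrow> t \<in> upper_box x \<and> t \<in> upper_box y"
      by (auto simp: upper_box_def z_def)
    ultimately show ?thesis by (auto simp: indicator_def)
  qed
  then have "box_kernel x y = (LINT t|lborel. indicator (upper_box z) t)"
    by (simp add: box_kernel_def set_lebesgue_integral_def)
  then show ?thesis
    using m meas by (simp add: z_def)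
qed

lemma box_kernel_bounds:
  fixes x y :: "real ^ 'n"
  assumes "x \<in> cbox 0 1" "y \<in> cbox 0 1"
  shows "0 \<le> box_kernel x y" "box_kernel x y \<le> 1"
  using assms unfolding box_kernel_eq_prod[OF assms]
  by (auto intro!: prod_nonneg prod_le_1 simp: mem_box_cart le_max_iff_disj)

text \<open>The left side is the squared Hilbert space distance of the kernel sections at
  \<open>x\<close> and \<open>y\<close>. On the cube all factors of the product formula lie in
  [0,1], so \<open>norm_prod_diff\<close> bounds a difference of products by the sum of the
  differences of the factors. The two resulting sums add up to the l1 distance of \<open>x\<close>
  and \<open>y\<close>, and bounding each coordinate by the Euclidean distance produces the
  dimension factor.\<close>

lemma box_kernel_sq_dist:
  fixes x y :: "real ^ 'n"
  assumes "x \<in> cbox 0 1" "y \<in> cbox 0 1"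
  shows "box_kernel x x - box_kernel x y - box_kernel y x + box_kernel y y \<le> real CARD('n) * dist x y"
proof -
  have *: "(\<Prod>i\<in>UNIV. 1 - u $ i) - (\<Prod>i\<in>UNIV. 1 - max (u $ i) (v $ i))
      \<le> (\<Sum>i\<in>UNIV. max (u $ i) (v $ i) - u $ i)"
    if "u \<in> cbox 0 1" "v \<in> cbox 0 1" for u v :: "real ^ 'n"
  proof -
    have "norm ((\<Prod>i\<in>UNIV. 1 - u $ i) - (\<Prod>i\<in>UNIV. 1 - max (u $ i) (v $ i)))
      \<le> (\<Sum>i\<in>UNIV. norm ((1 - u $ i) - (1 - max (u $ i) (v $ i))))"
      using that by (intro norm_prod_diff) (auto simp: mem_box_cart max_def)
    also have "\<dots> = (\<Sum>i\<in>UNIV. max (u $ i) (v $ i) - u $ i)"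
      by (intro sum.cong) auto
    finally show ?thesis by simp
  qed
  have "box_kernel x x - box_kernel x y - box_kernel y x + box_kernel y y
    \<le> (\<Sum>i\<in>UNIV. max (x $ i) (y $ i) - x $ i) + (\<Sum>i\<in>UNIV. max (y $ i) (x $ i) - y $ i)"
    using *[OF assms] *[OF assms(2,1)] assms by (simp add: box_kernel_eq_prod)
  also have "\<dots> = (\<Sum>i\<in>UNIV. \<bar>(x - y) $ i\<bar>)"
    unfolding sum.distrib[symmetric] by (intro sum.cong) (auto simp: max_def)
  also have "\<dots> \<le> (\<Sum>i\<in>(UNIV::'n set). dist x y)"
    unfolding dist_norm by (intro sum_mono component_le_norm_cart)
  finally show ?thesis by simp
qed

lemma continuous_on_clamp:
  fixes a b :: "'a::euclidean_space"
  shows "continuous_on S (clamp a b)"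
  using clamp_continuous_on[of a b "\<lambda>x. x"] by simp

section \<open>Inner product algebra and point evaluation in a reproducing kernel Hilbert
  space\<close>

context rkhs
begin

abbreviation sect :: "'a \<Rightarrow> 'a \<Rightarrow> real" where
  "sect y \<equiv> (\<lambda>x. if x \<in> X then K x y else 0)"

lemma diff_mem: "f \<in> H \<Longrightarrow> g \<in> H \<Longrightarrow> (\<lambda>x. f x - g x) \<in> H"
  using add_mem[OF _ scale_mem, of f g "-1"] by simp

lemma ip_diff:
  assumes "f \<in> H" "g \<in> H" "h \<in> H"
  shows "ip (\<lambda>x. f x - g x) h = ip f h - ip g h"
  using ip_add[OF assms(1) scale_mem[OF assms(2)] assms(3), of "-1"] ip_scale[OF assms(2,3), of "-1"]
  by simp

lemma ip_diff_right:
  assumes "f \<in> H" "g \<in> H" "h \<in> H"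
  shows "ip h (\<lambda>x. f x - g x) = ip h f - ip h g"
  using ip_diff[OF assms] assms by (simp add: ip_commute[of h] diff_mem)

lemma sum_mem: "(\<And>i. i \<in> I \<Longrightarrow> h i \<in> H) \<Longrightarrow> (\<lambda>x. \<Sum>i\<in>I. h i x) \<in> H"
  by (induction I rule: infinite_finite_induct) (auto intro: zero_mem add_mem)

lemma ip_zero: "h \<in> H \<Longrightarrow> ip (\<lambda>x. 0) h = 0"
  using ip_scale[of h h 0] by simp

lemma ip_sum:
  "(\<And>i. i \<in> I \<Longrightarrow> h i \<in> H) \<Longrightarrow> g \<in> H \<Longrightarrow> ip (\<lambda>x. \<Sum>i\<in>I. h i x) g = (\<Sum>i\<in>I. ip (h i) g)"
  by (induction I rule: infinite_finite_induct) (auto simp: ip_zero ip_add sum_mem)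

lemma ip_sum_right:
  "(\<And>i. i \<in> I \<Longrightarrow> h i \<in> H) \<Longrightarrow> g \<in> H \<Longrightarrow> ip g (\<lambda>x. \<Sum>i\<in>I. h i x) = (\<Sum>i\<in>I. ip g (h i))"
  using ip_sum[of I h g] by (simp add: ip_commute[of g] sum_mem)

text \<open>The squared norm of \<open>f - c * g\<close> is nonnegative, in particular at its
  minimiser \<open>c = ip f g / ip g g\<close>. If \<open>ip g g = 0\<close>, definiteness makes
  \<open>g\<close> the zero function.\<close>

lemma cauchy_schwarz:
  assumes f: "f \<in> H" and g: "g \<in> H"
  shows "(ip f g)\<^sup>2 \<le> ip f f * ip g g"
proof -
  have *: "0 \<le> ip f f - 2 * c * ip f g + c\<^sup>2 * ip g g" for c
  proof -
    have "ip (\<lambda>x. f x - c * g x) (\<lambda>x. f x - c * g x) = ip f f - 2 * c * ip f g + c\<^sup>2 * ip g g"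
      using f g scale_mem[OF g, of c] ip_commute[OF f scale_mem[OF g, of c]] ip_commute[OF g scale_mem[OF g, of c]]
        ip_commute[OF f g]
      by (simp add: ip_diff ip_diff_right ip_scale diff_mem power2_eq_square)
    then show ?thesis
      using ip_nonneg[OF diff_mem[OF f scale_mem[OF g, of c]]] by simp
  qed
  show ?thesis
  proof (cases "ip g g = 0")
    case True
    then have "ip f g = 0"
      using ip_definite[OF g] ip_zero[OF f] ip_commute[OF f g] by simp
    then show ?thesis using True by simp
  next
    case False
    then have "ip g g > 0" using ip_nonneg[OF g] by simp
    then show ?thesis
      using *[of "ip f g / ip g g"] by (simp add: field_simps power2_eq_square)
  qed
qed

text \<open>By the reproducing property the sum of differences is the inner product of
  \<open>f\<close> with the sum of the \<open>h i\<close>, and the double sum is the squared norm of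
  that representer. The first claim is then Cauchy-Schwarz; the second allows the factor
  \<open>ip f f\<close> to be replaced by 1 on the unit ball.\<close>

lemma sum_eval_diff_sq_le:
  assumes f: "f \<in> H" and p: "\<And>i. i \<in> I \<Longrightarrow> p i \<in> X" and q: "\<And>i. i \<in> I \<Longrightarrow> q i \<in> X"
  shows "(\<Sum>i\<in>I. f (p i) - f (q i))\<^sup>2
    \<le> ip f f * (\<Sum>i\<in>I. \<Sum>j\<in>I. K (p i) (p j) - K (p i) (q j) - K (q i) (p j) + K (q i) (q j))"
      (is "_ \<le> ip f f * ?T")
    and "0 \<le> (\<Sum>i\<in>I. \<Sum>j\<in>I. K (p i) (p j) - K (p i) (q j) - K (q i) (p j) + K (q i) (q j))"
proof -
  define h where "h i x = sect (p i) x - sect (q i) x" for i x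
  have h: "h i \<in> H" if "i \<in> I" for i
    unfolding h_def using that by (intro diff_mem kernel_mem p q)
  have ip_h: "ip g (h i) = g (p i) - g (q i)" if "g \<in> H" "i \<in> I" for g i
    unfolding h_def using that p q by (simp add: ip_diff_right kernel_mem reproducing[symmetric])
  have "ip f (\<lambda>x. \<Sum>i\<in>I. h i x) = (\<Sum>i\<in>I. f (p i) - f (q i))"
    using f h by (simp add: ip_sum_right ip_h)
  moreover have "ip (\<lambda>x. \<Sum>i\<in>I. h i x) (\<lambda>x. \<Sum>i\<in>I. h i x) = ?T"
  proof -
    have "ip (h j) (h i) = K (p i) (p j) - K (p i) (q j) - K (q i) (p j) + K (q i) (q j)"
      if "i \<in> I" "j \<in> I" for i j
      using that p q by (simp add: ip_h h) (simp add: h_def)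
    then show ?thesis
      using h by (simp add: ip_sum_right ip_sum sum_mem)
  qed
  ultimately show "(\<Sum>i\<in>I. f (p i) - f (q i))\<^sup>2 \<le> ip f f * ?T" "0 \<le> ?T"
    using cauchy_schwarz[OF f sum_mem[of I h]] ip_nonneg[OF sum_mem[of I h]] h by simp_all
qed

lemma eval_sq_le:
  assumes f: "f \<in> H" and p: "p \<in> X"
  shows "(f p)\<^sup>2 \<le> ip f f * K p p"
  using cauchy_schwarz[OF f kernel_mem[OF p]] p f
  by (simp add: reproducing[symmetric] kernel_mem)

end

text \<open>A one-term instance of \<open>sum_eval_diff_sq_le\<close>, combined with
  \<open>box_kernel_sq_dist\<close>, shows that \<open>f\<close> is Hoelder continuous with exponent
  1/2 on the cube. Continuity later yields the measurability of \<open>f\<close> and of the supremum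
  over the unit ball.\<close>

lemma rkhs_box_kernel_continuous_on:
  fixes f :: "real ^ 'n \<Rightarrow> real"
  assumes "rkhs (cbox 0 1) box_kernel H ip" and f: "f \<in> H"
  shows "continuous_on (cbox 0 1) f"
proof -
  interpret rkhs "cbox 0 1" box_kernel H ip by fact
  have *: "dist (f x) (f y) \<le> sqrt (ip f f * (real CARD('n) * dist x y))"
    if "x \<in> cbox 0 1" "y \<in> cbox 0 1" for x y
  proof -
    have "(f x - f y)\<^sup>2 \<le> ip f f * (real CARD('n) * dist x y)"
      using sum_eval_diff_sq_le(1)[OF f, of "{()}" "\<lambda>_. x" "\<lambda>_. y"] that
        mult_left_mono[OF box_kernel_sq_dist[OF that] ip_nonneg[OF f]]
      by simp
    then show ?thesis
      by (simp add: dist_real_def real_le_rsqrt)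
  qed
  show ?thesis
    unfolding continuous_on_def
  proof
    fix x :: "real ^ 'n" assume x: "x \<in> cbox 0 1"
    have "((\<lambda>y. sqrt (ip f f * (real CARD('n) * dist y x))) \<longlongrightarrow> sqrt (ip f f * (real CARD('n) * dist x x)))
        (at x within cbox 0 1)"
      by (intro tendsto_intros)
    then have lim: "((\<lambda>y. sqrt (ip f f * (real CARD('n) * dist y x))) \<longlongrightarrow> 0) (at x within cbox 0 1)"
      by simp
    show "(f \<longlongrightarrow> f x) (at x within cbox 0 1)"
      unfolding tendsto_dist_iff[of f]
      by (rule tendsto_sandwich[OF _ _ tendsto_const lim])
        (auto simp: eventually_at_filter x intro!: always_eventually *)
  qed
qed

section \<open>Jensen's inequality for squares, and expectations of functions of independent
  pairs\<close>

lemma (in prob_space) expectation_square_le: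
  fixes X :: "'a \<Rightarrow> real"
  assumes "integrable M X" "integrable M (\<lambda>\<omega>. (X \<omega>)\<^sup>2)"
  shows "(expectation X)\<^sup>2 \<le> expectation (\<lambda>\<omega>. (X \<omega>)\<^sup>2)"
  using variance_positive[of X] variance_eq[OF assms] by simp

lemma (in prob_space) indep_vars_imp_indep_var:
  assumes "indep_vars M' X I" "i \<in> I" "j \<in> I" "i \<noteq> j"
  shows "indep_var (M' i) (X i) (M' j) (X j)"
proof -
  have "indep_var (PiM {i} M') (\<lambda>\<omega>. restrict (\<lambda>i. X i \<omega>) {i}) (PiM {j} M') (\<lambda>\<omega>. restrict (\<lambda>i. X i \<omega>) {j})"
    using assms by (intro indep_var_restrict) auto
  then have "indep_var (M' i) ((\<lambda>f. f i) \<circ> (\<lambda>\<omega>. restrict (\<lambda>i. X i \<omega>) {i}))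
      (M' j) ((\<lambda>f. f j) \<circ> (\<lambda>\<omega>. restrict (\<lambda>i. X i \<omega>) {j}))"
    by (rule indep_var_compose) auto
  then show ?thesis by (simp add: comp_def)
qed

text \<open>Independence makes the joint law the product of the marginal laws, and Fubini in either
  order gives the two formulas. The second sample point plays the role of an independent copy,
  without enlarging the probability space.\<close>

lemma (in prob_space) expectation_indep_var:
  fixes k :: "'b \<times> 'b \<Rightarrow> real"
  assumes ind: "indep_var S X T Y" and k: "k \<in> borel_measurable (S \<Otimes>\<^sub>M T)"
    and bd: "\<And>\<omega> \<omega>'. \<bar>k (X \<omega>, Y \<omega>')\<bar> \<le> B"
  shows "expectation (\<lambda>\<omega>. k (X \<omega>, Y \<omega>)) = expectation (\<lambda>\<omega>. expectation (\<lambda>\<omega>'. k (X \<omega>, Y \<omega>')))"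
    and "expectation (\<lambda>\<omega>. k (X \<omega>, Y \<omega>)) = expectation (\<lambda>\<omega>. expectation (\<lambda>\<omega>'. k (X \<omega>', Y \<omega>)))"
proof -
  note [measurable] = k
  have [measurable]: "X \<in> measurable M S" "Y \<in> measurable M T"
    using ind by (auto dest: indep_var_rv1 indep_var_rv2)
  interpret X: prob_space "distr M S X" by (rule prob_space_distr) simp
  interpret Y: prob_space "distr M T Y" by (rule prob_space_distr) simp
  interpret P: pair_sigma_finite "distr M S X" "distr M T Y" ..
  have eq: "distr M S X \<Otimes>\<^sub>M distr M T Y = distr M (S \<Otimes>\<^sub>M T) (\<lambda>\<omega>. (X \<omega>, Y \<omega>))"
    using ind by (simp add: indep_var_distribution_eq)
  have "integrable M (\<lambda>\<omega>. k (X \<omega>, Y \<omega>))"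
    using bd by (intro integrable_const_bound[of _ B]) auto
  then have int: "integrable (distr M S X \<Otimes>\<^sub>M distr M T Y) k"
    unfolding eq by (subst integrable_distr_eq) auto
  have "expectation (\<lambda>\<omega>. k (X \<omega>, Y \<omega>)) = integral\<^sup>L (distr M S X \<Otimes>\<^sub>M distr M T Y) k"
    unfolding eq by (subst integral_distr) auto
  note this[symmetric]
  moreover have "integral\<^sup>L (distr M S X \<Otimes>\<^sub>M distr M T Y) k
      = (\<integral>x. \<integral>y. k (x, y) \<partial>distr M T Y \<partial>distr M S X)"
    by (rule P.integral_fst'[OF int, symmetric])
  moreover have "\<dots> = expectation (\<lambda>\<omega>. expectation (\<lambda>\<omega>'. k (X \<omega>, Y \<omega>')))"
    by (subst integral_distr, simp, simp) (intro Bochner_Integration.integral_cong refl integral_distr; simp)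
  moreover have "integral\<^sup>L (distr M S X \<Otimes>\<^sub>M distr M T Y) k
      = (\<integral>y. \<integral>x. k (x, y) \<partial>distr M S X \<partial>distr M T Y)"
    using P.integral_snd[of "\<lambda>x y. k (x, y)"] int by simp
  moreover have "\<dots> = expectation (\<lambda>\<omega>. expectation (\<lambda>\<omega>'. k (X \<omega>', Y \<omega>)))"
    by (subst integral_distr, simp, simp) (intro Bochner_Integration.integral_cong refl integral_distr; simp)
  ultimately show "expectation (\<lambda>\<omega>. k (X \<omega>, Y \<omega>)) = expectation (\<lambda>\<omega>. expectation (\<lambda>\<omega>'. k (X \<omega>, Y \<omega>')))"
    "expectation (\<lambda>\<omega>. k (X \<omega>, Y \<omega>)) = expectation (\<lambda>\<omega>. expectation (\<lambda>\<omega>'. k (X \<omega>', Y \<omega>)))"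
    by simp_all
qed

text \<open>All four terms have the same double expectation: the mixed ones by
  \<open>expectation_indep_var\<close>, the last one by renaming the variable. The signs then
  cancel. This removes the cross terms of the squared norm.\<close>

lemma (in prob_space) expectation_cross_difference_eq_0:
  fixes k :: "'b \<times> 'b \<Rightarrow> real"
  assumes ind: "indep_var S X T Y" and k: "k \<in> borel_measurable (S \<Otimes>\<^sub>M T)"
    and bd: "\<And>\<omega> \<omega>'. \<bar>k (X \<omega>, Y \<omega>')\<bar> \<le> B"
  shows "expectation (\<lambda>\<omega>. expectation (\<lambda>\<omega>'.
      k (X \<omega>, Y \<omega>) - k (X \<omega>, Y \<omega>') - k (X \<omega>', Y \<omega>) + k (X \<omega>', Y \<omega>'))) = 0"
proof -
  note [measurable] = k
  have [measurable]: "X \<in> measurable M S" "Y \<in> measurable M T"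
    using ind by (auto dest: indep_var_rv1 indep_var_rv2)
  have B: "0 \<le> B" using bd[of undefined undefined] by simp
  have int: "integrable M (\<lambda>\<omega>'. k (X \<omega>, Y \<omega>'))" "integrable M (\<lambda>\<omega>'. k (X \<omega>', Y \<omega>))" 
     "integrable M (\<lambda>\<omega>. k (X \<omega>, Y \<omega>))" if "\<omega> \<in> space M" for \<omega>
    using bd that by (auto intro!: integrable_const_bound[of _ B])
  have int2: "integrable M (\<lambda>\<omega>. k (X \<omega>, Y \<omega>))"
    using bd by (auto intro!: integrable_const_bound[of _ B])
  \<comment> \<open>The integral of a non-integrable function is 0 by convention, so the bound
    persists in that case because \<open>0 \<le> B\<close>.\<close>
  have le: "\<bar>expectation g\<bar> \<le> B" if "\<And>\<omega>. \<bar>g \<omega>\<bar> \<le> B" for g :: "'a \<Rightarrow> real"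
  proof (cases "integrable M g")
    case True
    then show ?thesis
      using integral_mono[of M "\<lambda>\<omega>. \<bar>g \<omega>\<bar>" "\<lambda>_. B"] that
      by (auto simp: prob_space intro: order_trans[OF integral_abs_bound])
  next
    case False
    then show ?thesis using B by (simp add: not_integrable_integral_eq)
  qed
  have int3: "integrable M (\<lambda>\<omega>. expectation (\<lambda>\<omega>'. k (X \<omega>, Y \<omega>')))"
      "integrable M (\<lambda>\<omega>. expectation (\<lambda>\<omega>'. k (X \<omega>', Y \<omega>)))"
    using bd by (auto intro!: integrable_const_bound[of _ B] AE_I2 le)
  have "expectation (\<lambda>\<omega>. expectation (\<lambda>\<omega>'.
      k (X \<omega>, Y \<omega>) - k (X \<omega>, Y \<omega>') - k (X \<omega>', Y \<omega>) + k (X \<omega>', Y \<omega>'))) =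
    expectation (\<lambda>\<omega>. k (X \<omega>, Y \<omega>) - expectation (\<lambda>\<omega>'. k (X \<omega>, Y \<omega>'))
      - expectation (\<lambda>\<omega>'. k (X \<omega>', Y \<omega>)) + expectation (\<lambda>\<omega>'. k (X \<omega>', Y \<omega>')))"
    by (intro Bochner_Integration.integral_cong refl) (simp add: int prob_space)
  also have "\<dots> = 0"
    using int2 int3 expectation_indep_var[OF assms] by (simp add: prob_space)
  finally show ?thesis .
qed

text \<open>The supremum may be uncountable: it is measurable because it is lower semicontinuous.\<close>

lemma borel_measurable_SUP_continuous:
  fixes g :: "'i \<Rightarrow> 'a::topological_space \<Rightarrow> ennreal"
  assumes "\<And>f. f \<in> F \<Longrightarrow> continuous_on UNIV (g f)"
  shows "(\<lambda>x. SUP f\<in>F. g f x) \<in> borel_measurable borel"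
proof (rule borel_measurableI_greater)
  fix a
  have "{x \<in> space borel. a < (SUP f\<in>F. g f x)} = (\<Union>f\<in>F. {x. a < g f x})"
    by (auto simp: less_SUP_iff)
  also have "open \<dots>"
    using assms by (intro open_UN ballI open_Collect_less) auto
  finally show "{x \<in> space borel. a < (SUP f\<in>F. g f x)} \<in> sets borel" by simp
qed

section \<open>Uniform distribution on Lebesgue measurable cells, and measurability of the
  supremum\<close>

lemma measurable_ident_uniform_measure_lebesgue:
  "(\<lambda>x. x) \<in> measurable (uniform_measure lebesgue A) borel"
  unfolding measurable_cong_sets[OF sets_uniform_measure refl] by (rule measurable_completion) simp

text \<open>The set \<open>A\<close> need not be Borel, so \<open>Y \<omega> \<in> A\<close> need
  not define an event. A closed superset is Borel, and there the two equal laws can be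
  compared.\<close>

lemma uniformly_distributed_in_AE_closed:
  fixes Y :: "'w \<Rightarrow> real ^ 'n"
  assumes Y: "uniformly_distributed_in M Y A" and A: "A \<in> sets lebesgue" and C: "closed C" "A \<subseteq> C"
  shows "AE \<omega> in M. Y \<omega> \<in> C"
proof -
  have [measurable]: "Y \<in> borel_measurable M" and eq: "distr M borel Y = distr (uniform_measure lebesgue A) borel (\<lambda>x. x)"
    using Y by (auto simp: uniformly_distributed_in_def)
  have CB: "{x \<in> space borel. x \<in> C} \<in> sets borel" using C by simp
  have "AE x in uniform_measure lebesgue A. x \<in> C"
    using C by (intro AE_uniform_measureI A) auto
  then have "AE x in distr (uniform_measure lebesgue A) borel (\<lambda>x. x). x \<in> C"
    by (subst AE_distr_iff[OF measurable_ident_uniform_measure_lebesgue CB])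
  then show ?thesis
    unfolding eq[symmetric] by (subst (asm) AE_distr_iff) (use CB in auto)
qed

lemma uniformly_distributed_in_integral:
  fixes Y :: "'w \<Rightarrow> real ^ 'n" and f :: "real ^ 'n \<Rightarrow> real"
  assumes Y: "uniformly_distributed_in M Y A" and A: "A \<in> sets lebesgue" "measure lebesgue A > 0"
    and f: "f \<in> borel_measurable borel"
  shows "(\<integral>\<omega>. f (Y \<omega>) \<partial>M) = (LINT x:A|lebesgue. f x) / measure lebesgue A"
proof -
  have [measurable]: "Y \<in> borel_measurable M" and eq: "distr M borel Y = distr (uniform_measure lebesgue A) borel (\<lambda>x. x)"
    using Y by (auto simp: uniformly_distributed_in_def)
  note [measurable] = f A(1)
  have fl[measurable]: "f \<in> borel_measurable lebesgue"
    by (rule measurable_completion) simp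
  \<comment> \<open>A set of infinite \<open>emeasure\<close> has \<open>measure\<close> 0, so
    positivity of the latter forces finiteness.\<close>
  have em: "emeasure lebesgue A = ennreal (measure lebesgue A)"
    using A(2) by (metis emeasure_eq_ennreal_measure measure_zero_top less_irrefl)
  have "(\<integral>\<omega>. f (Y \<omega>) \<partial>M) = integral\<^sup>L (distr M borel Y) f"
    by (subst integral_distr) auto
  also have "\<dots> = integral\<^sup>L (uniform_measure lebesgue A) f"
    unfolding eq by (subst integral_distr[OF measurable_ident_uniform_measure_lebesgue]) auto
  also have "uniform_measure lebesgue A = density lebesgue (\<lambda>x. ennreal (indicator A x / measure lebesgue A))"
    unfolding uniform_measure_def em using A(2)
    by (intro density_cong) (auto simp: divide_ennreal[symmetric] ennreal_indicator split: split_indicator)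
  also have "integral\<^sup>L \<dots> f = (\<integral>x. (indicator A x / measure lebesgue A) *\<^sub>R f x \<partial>lebesgue)"
    by (subst integral_density) auto
  also have "\<dots> = (LINT x:A|lebesgue. f x) / measure lebesgue A"
    by (simp add: set_lebesgue_integral_def)
  finally show ?thesis .
qed

text \<open>The integral splits over the cells, and on each cell it is the cell volume 1/N times the
  mean of \<open>f\<close> at the random point of that cell. The splitting takes place under
  \<open>lebesgue\<close> instead of \<open>lborel\<close> because the cells may fail to be
  Borel.\<close>

lemma equal_measure_partition_integral:
  fixes \<Omega> :: "nat \<Rightarrow> (real ^ 'n) set" and f :: "real ^ 'n \<Rightarrow> real"
  assumes part: "equal_measure_partition c1 c2 N \<Omega>" and N: "N \<ge> 1"
    and Y: "\<And>j. j \<in> {1..N} \<Longrightarrow> uniformly_distributed_in M (Y j) (\<Omega> j)"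
    and f[measurable]: "f \<in> borel_measurable borel" and bd: "\<And>x. x \<in> cbox 0 1 \<Longrightarrow> \<bar>f x\<bar> \<le> B"
  shows "(LINT x:cbox 0 1|lborel. f x) = (1 / real N) * (\<Sum>n=1..N. \<integral>\<omega>. f (Y n \<omega>) \<partial>M)"
proof -
  have \<Omega>: "\<And>j. j \<in> {1..N} \<Longrightarrow> \<Omega> j \<in> sets lebesgue"
    "\<And>j. j \<in> {1..N} \<Longrightarrow> measure lebesgue (\<Omega> j) = 1 / real N"
    "disjoint_family_on \<Omega> {1..N}" and un: "(\<Union>j\<in>{1..N}. \<Omega> j) = cbox 0 1"
    using part by (auto simp: equal_measure_partition_def)
  have int: "set_integrable lebesgue (cbox 0 1) f"
    unfolding set_integrable_def
  proof (rule Bochner_Integration.integrable_bound)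
    show "integrable lebesgue (\<lambda>x::real ^ 'n. B * indicator (cbox 0 1) x)"
      by (intro integrable_mult_right integrable_real_indicator)
        (simp_all add: emeasure_lborel_cbox_finite[unfolded infinity_ennreal_def])
    show "AE x in lebesgue. norm (indicator (cbox 0 1) x *\<^sub>R f x) \<le> norm (B * indicator (cbox 0 1) x)"
      using bd by (intro AE_I2) (force split: split_indicator)
    show "(\<lambda>x. indicator (cbox 0 1) x *\<^sub>R f x) \<in> borel_measurable lebesgue"
      by (rule measurable_completion) measurable
  qed
  have "(LINT x:cbox 0 1|lborel. f x) = (LINT x:cbox 0 1|lebesgue. f x)"
    unfolding set_lebesgue_integral_def by (subst integral_completion) auto
  also have "\<dots> = (\<Sum>n=1..N. LINT x:\<Omega> n|lebesgue. f x)"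
    unfolding un[symmetric] using \<Omega> un
    by (intro set_integral_finite_Union) (auto intro!: set_integrable_subset[OF int])
  also have "\<dots> = (\<Sum>n=1..N. (1 / real N) * (\<integral>\<omega>. f (Y n \<omega>) \<partial>M))"
    using N by (intro sum.cong refl) (simp add: uniformly_distributed_in_integral[OF Y \<Omega>(1) _ f] \<Omega>(2))
  finally show ?thesis by (simp add: sum_distrib_left)
qed

text \<open>For uncountable \<open>F\<close>, measurability of each error does not suffice. The
  errors are therefore written as continuous functions \<open>g f\<close> of a single measurable map
  \<Phi> into a product space, where \<open>borel_measurable_SUP_continuous\<close> applies;
  \<open>clamp\<close> extends each \<open>f\<close> continuously from the box to the whole
  space.\<close>

lemma borel_measurable_SUP_quadrature_error:
  fixes F :: "('a::euclidean_space \<Rightarrow> real) set" and Y :: "nat \<Rightarrow> 'w \<Rightarrow> 'a" and c :: "('a \<Rightarrow> real) \<Rightarrow> real"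
  assumes cont: "\<And>f. f \<in> F \<Longrightarrow> continuous_on (cbox a b) f"
    and outside: "\<And>f x. f \<in> F \<Longrightarrow> x \<notin> cbox a b \<Longrightarrow> f x = 0"
    and Y: "\<And>n. n \<in> {1..N} \<Longrightarrow> Y n \<in> borel_measurable M"
  shows "(\<lambda>\<omega>. SUP f\<in>F. ennreal (\<bar>w * (\<Sum>n=1..N. f (Y n \<omega>)) - c f\<bar>\<^sup>2)) \<in> borel_measurable M"
proof -
  define g where "g f z = ennreal (\<bar>w * (\<Sum>n=1..N. fst (z n) * f (clamp a b (snd (z n)))) - c f\<bar>\<^sup>2)"
    for f and z :: "nat \<Rightarrow> real \<times> 'a"
  \<comment> \<open>The functions jump to 0 outside the box; carrying the indicator of the box as an extra
    coordinate makes the integrand a continuous function of \<open>\<Phi> \<omega>\<close>.\<close>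
  define \<Phi> where "\<Phi> \<omega> n = (if n \<in> {1..N} then (indicator (cbox a b) (Y n \<omega>) :: real, Y n \<omega>) else (0, 0))" for \<omega> n
  have "continuous_on UNIV (g f)" if "f \<in> F" for f
  proof -
    have coord: "continuous_on UNIV (\<lambda>z :: nat \<Rightarrow> real \<times> 'a. z n)" for n
      by (rule continuous_on_product_coordinates)
    have "continuous_on UNIV (\<lambda>z :: nat \<Rightarrow> real \<times> 'a. f (clamp a b (snd (z n))))" for n
      by (rule continuous_on_compose2[OF clamp_continuous_on[OF cont[OF that], of UNIV] continuous_on_snd[OF coord]]) simp
    then show ?thesis unfolding g_def
      by (intro continuous_on_ennreal continuous_on_power continuous_on_rabs continuous_on_diff continuous_on_const
          continuous_on_mult continuous_on_sum continuous_on_fst coord)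
  qed
  then have "(\<lambda>z. SUP f\<in>F. g f z) \<in> borel_measurable borel"
    by (rule borel_measurable_SUP_continuous)
  moreover have "\<Phi> \<in> borel_measurable M"
  proof (rule measurable_coordinatewise_then_product)
    fix n
    show "(\<lambda>\<omega>. \<Phi> \<omega> n) \<in> borel_measurable M"
    proof (cases "n \<in> {1..N}")
      case True
      note [measurable] = Y[OF this]
      show ?thesis unfolding \<Phi>_def using True by simp
    next
      case False
      then have "(\<lambda>\<omega>. \<Phi> \<omega> n) = (\<lambda>_. (0, 0))" by (auto simp: \<Phi>_def)
      then show ?thesis by simp
    qed
  qed
  ultimately have "(\<lambda>\<omega>. SUP f\<in>F. g f (\<Phi> \<omega>)) \<in> borel_measurable M"
    by (rule measurable_compose[rotated])
  moreover have "g f (\<Phi> \<omega>) = ennreal (\<bar>w * (\<Sum>n=1..N. f (Y n \<omega>)) - c f\<bar>\<^sup>2)" if "f \<in> F" for f \<omega>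
  proof -
    have "fst (\<Phi> \<omega> n) * f (clamp a b (snd (\<Phi> \<omega> n))) = f (Y n \<omega>)" if "n \<in> {1..N}" for n
      using that outside[OF \<open>f \<in> F\<close>] by (auto simp: \<Phi>_def indicator_def)
    then have "(\<Sum>n=1..N. fst (\<Phi> \<omega> n) * f (clamp a b (snd (\<Phi> \<omega> n)))) = (\<Sum>n=1..N. f (Y n \<omega>))"
      by (rule sum.cong[OF refl])
    then show ?thesis unfolding g_def by (rule arg_cong)
  qed
  ultimately show ?thesis by (simp cong: SUP_cong)
qed

section \<open>The mean square worst-case error of quadrature with one random point per cell\<close>

theorem theorem3p1:
  fixes \<Omega> :: "nat \<Rightarrow> (real ^ 'n) set" and Y :: "nat \<Rightarrow> 'w \<Rightarrow> real ^ 'n"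
    and M :: "'w measure" and N :: nat and c1 c2 :: real
    and H :: "(real ^ 'n \<Rightarrow> real) set"
    and ip :: "(real ^ 'n \<Rightarrow> real) \<Rightarrow> (real ^ 'n \<Rightarrow> real) \<Rightarrow> real"
  assumes "CARD('n) \<ge> 2" and "N \<ge> 1" and "c1 > 0" and "c2 > 0"
    and "equal_measure_partition c1 c2 N \<Omega>"
    and "rkhs (cbox 0 1) box_kernel H ip"
    and "prob_space M"
    and "prob_space.indep_vars M (\<lambda>_. borel) Y {1..N}"
    and "\<And>j. j \<in> {1..N} \<Longrightarrow> uniformly_distributed_in M (Y j) (\<Omega> j)"
  shows "let sup_error = (\<lambda>\<omega>. SUP f\<in>{f \<in> H. sqrt (ip f f) \<le> 1}.
             ennreal (\<bar>(1 / real N) * (\<Sum>n=1..N. f (Y n \<omega>)) - (LINT x:cbox 0 1|lborel. f x)\<bar>\<^sup>2))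
         in sup_error \<in> borel_measurable M \<and>
            (\<integral>\<^sup>+\<omega>. sup_error \<omega> \<partial>M)
              \<le> ennreal (real CARD('n) * c2 / real N powr (1 + 1 / real CARD('n)))"
proof -
  interpret rkhs "cbox 0 1" box_kernel H ip by fact
  interpret prob_space M by fact
  note N = \<open>N \<ge> 1\<close> and part = assms(5) and ind = assms(8) and Y = assms(9)
  let ?F = "{f \<in> H. sqrt (ip f f) \<le> 1}"
  define sup_error where "sup_error \<omega> = (SUP f\<in>?F.
    ennreal (\<bar>(1 / real N) * (\<Sum>n=1..N. f (Y n \<omega>)) - (LINT x:cbox 0 1|lborel. f x)\<bar>\<^sup>2))" for \<omega>
  have Ym: "Y j \<in> borel_measurable M" if "j \<in> {1..N}" for j
    using Y[OF that] by (simp add: uniformly_distributed_in_def)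
  have cont: "continuous_on (cbox 0 1) f" if "f \<in> H" for f
    by (rule rkhs_box_kernel_continuous_on[OF assms(6) that])
  have fm: "f \<in> borel_measurable borel" if "f \<in> H" for f
  proof -
    \<comment> \<open>Members of \<open>H\<close> vanish outside the cube, so multiplying by its
      indicator changes nothing, and continuity on the cube gives Borel measurability
      everywhere.\<close>
    have "(\<lambda>x. indicator (cbox 0 1) x *\<^sub>R f x) \<in> borel_measurable borel"
      by (intro borel_measurable_continuous_on_indicator cont that) simp
    also have "(\<lambda>x. indicator (cbox 0 1) x *\<^sub>R f x) = f"
      using vanishes_outside[OF that] by (auto simp: indicator_def fun_eq_iff)
    finally show ?thesis .
  qed
  have meas: "sup_error \<in> borel_measurable M"
    unfolding sup_error_def[abs_def]
    by (rule borel_measurable_SUP_quadrature_error[of _ 0 1]) (auto simp: cont vanishes_outside Ym)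

  define diam where "diam = c2 * real N powr (- 1 / real CARD('n))"
  have \<Omega>: "\<Omega> j \<in> sets lebesgue" "\<Omega> j \<subseteq> cbox 0 1" "diameter (\<Omega> j) \<le> diam"
    if "j \<in> {1..N}" for j
    using that part by (auto simp: equal_measure_partition_def diam_def)
  have bounded_\<Omega>: "bounded (\<Omega> j)" if "j \<in> {1..N}" for j
    by (rule bounded_subset[OF bounded_cbox \<Omega>(2)[OF that]])
  \<comment> \<open>Closures replace the possibly non-Borel cells. They stay inside the cube and
    have the same diameter.\<close>
  have AE_\<Omega>: "AE \<omega> in M. \<forall>j\<in>{1..N}. Y j \<omega> \<in> closure (\<Omega> j)"
    by (subst AE_finite_all) (auto intro!: uniformly_distributed_in_AE_closed[OF Y] \<Omega> closure_subset)
  have closure_cube: "closure (\<Omega> j) \<subseteq> cbox 0 1" if "j \<in> {1..N}" for j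
    by (rule closure_minimal[OF \<Omega>(2)[OF that] closed_cbox])
  have AE_cube: "AE \<omega> in M. \<forall>j\<in>{1..N}. Y j \<omega> \<in> cbox 0 1"
    using AE_\<Omega> by eventually_elim (use closure_cube in blast)

  \<comment> \<open>Clamping makes the kernel bounded and continuous everywhere; almost surely it changes nothing.\<close>
  define k :: "(real ^ 'n) \<times> (real ^ 'n) \<Rightarrow> real"
    where "k p = box_kernel (clamp 0 1 (fst p)) (clamp 0 1 (snd p))" for p
  have clamp_cube: "clamp 0 1 x \<in> cbox 0 1" for x :: "real ^ 'n"
    by (rule clamp_in_interval) (auto simp: Basis_vec_def inner_axis)
  have "continuous_on UNIV k"
    unfolding k_def box_kernel_eq_prod[OF clamp_cube clamp_cube]
    by (intro continuous_intros continuous_on_compose2[OF continuous_on_clamp[of UNIV]]) auto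
  then have k[measurable]: "k \<in> borel_measurable (borel \<Otimes>\<^sub>M borel)"
    by (simp add: borel_prod borel_measurable_continuous_onI)
  have k_bd: "\<bar>k p\<bar> \<le> 1" for p
    using box_kernel_bounds[OF clamp_cube clamp_cube] by (simp add: k_def)
  \<comment> \<open>With \<open>\<omega>'\<close> as the independent copy, this is the inner product
    of the differences of kernel sections at the \<open>i\<close>-th and the \<open>j\<close>-th
    point. Its sum over \<open>i\<close> and \<open>j\<close> is the squared norm of the sum of
    these differences.\<close>
  define D where "D i j \<omega> \<omega>' = k (Y i \<omega>, Y j \<omega>) - k (Y i \<omega>, Y j \<omega>') - k (Y i \<omega>', Y j \<omega>) + k (Y i \<omega>', Y j \<omega>')"
    for i j \<omega> \<omega>'
  have D_meas: "(\<lambda>p. D i j (fst p) (snd p)) \<in> borel_measurable (M \<Otimes>\<^sub>M M)" if "i \<in> {1..N}" "j \<in> {1..N}" for i j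
  proof -
    note [measurable] = Ym[OF that(1)] Ym[OF that(2)]
    show ?thesis unfolding D_def by measurable
  qed
  have D_bd: "\<bar>D i j \<omega> \<omega>'\<bar> \<le> 4" for i j \<omega> \<omega>'
    unfolding D_def
    using k_bd[of "(Y i \<omega>, Y j \<omega>)"] k_bd[of "(Y i \<omega>, Y j \<omega>')"] k_bd[of "(Y i \<omega>', Y j \<omega>)"] k_bd[of "(Y i \<omega>', Y j \<omega>')"]
    by linarith
  interpret PM: pair_prob_space M M ..
  have D_int2: "integrable (M \<Otimes>\<^sub>M M) (\<lambda>p. D i j (fst p) (snd p))" if "i \<in> {1..N}" "j \<in> {1..N}" for i j
    using D_meas[OF that] D_bd by (intro PM.P.integrable_const_bound[of _ 4]) auto
  have D_int: "integrable M (D i j \<omega>)" if "i \<in> {1..N}" "j \<in> {1..N}" "\<omega> \<in> space M" for i j \<omega>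
    using measurable_compose[OF measurable_Pair1'[OF that(3)] D_meas[OF that(1,2)]] D_bd
    by (intro integrable_const_bound[of _ 4]) auto
  have D_int1: "integrable M (\<lambda>\<omega>. expectation (D i j \<omega>))" if "i \<in> {1..N}" "j \<in> {1..N}" for i j
    using PM.integrable_fst'[OF D_int2[OF that]] by simp
  \<comment> \<open>Independence of the random points enters here.\<close>
  have D_off: "expectation (\<lambda>\<omega>. expectation (D i j \<omega>)) = 0" if "i \<in> {1..N}" "j \<in> {1..N}" "i \<noteq> j" for i j
    unfolding D_def
    by (rule expectation_cross_difference_eq_0[OF indep_vars_imp_indep_var[OF ind that] k k_bd])
  \<comment> \<open>Almost surely both copies of the \<open>i\<close>-th point lie in the closure of
    the same cell, so \<open>box_kernel_sq_dist\<close> bounds the squared norm by the dimension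
    times the cell diameter.\<close>
  have D_diag: "expectation (\<lambda>\<omega>. expectation (D i i \<omega>)) \<le> real CARD('n) * diam" if "i \<in> {1..N}" for i
  proof -
    have D_le: "D i i \<omega> \<omega>' \<le> real CARD('n) * diam"
      if "Y i \<omega> \<in> closure (\<Omega> i)" "Y i \<omega>' \<in> closure (\<Omega> i)" for \<omega> \<omega>'
    proof -
      have *: "Y i \<omega> \<in> cbox 0 1" "Y i \<omega>' \<in> cbox 0 1"
        using that closure_cube \<open>i \<in> {1..N}\<close> by auto
      have "dist (Y i \<omega>) (Y i \<omega>') \<le> diameter (closure (\<Omega> i))"
        using that bounded_\<Omega>[OF \<open>i \<in> {1..N}\<close>] by (intro diameter_bounded_bound) auto
      also have "\<dots> \<le> diam"
        using bounded_\<Omega>[OF \<open>i \<in> {1..N}\<close>] \<Omega>(3)[OF \<open>i \<in> {1..N}\<close>] by (simp add: diameter_closure)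
      finally have "real CARD('n) * dist (Y i \<omega>) (Y i \<omega>') \<le> real CARD('n) * diam"
        by (intro mult_left_mono) auto
      then show ?thesis
        using order_trans[OF box_kernel_sq_dist[OF *]] * by (simp add: D_def k_def)
    qed
    have "AE \<omega> in M. expectation (D i i \<omega>) \<le> real CARD('n) * diam"
      using AE_\<Omega> AE_space
    proof eventually_elim
      case (elim \<omega>)
      have "AE \<omega>' in M. D i i \<omega> \<omega>' \<le> real CARD('n) * diam"
        using AE_\<Omega> by eventually_elim (use elim that D_le in auto)
      then show ?case
        using integral_mono_AE[OF D_int[OF that that elim(2)], of "\<lambda>_. real CARD('n) * diam"]
        by (simp add: prob_space)
    qed
    then show ?thesis
      using integral_mono_AE[OF D_int1[OF that that], of "\<lambda>_. real CARD('n) * diam"]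
      by (simp add: prob_space)
  qed

  define S where "S \<omega> \<omega>' = (\<Sum>i=1..N. \<Sum>j=1..N. D i j \<omega> \<omega>') / (real N)\<^sup>2" for \<omega> \<omega>'
  have S_int: "integrable M (S \<omega>)" if "\<omega> \<in> space M" for \<omega>
    unfolding S_def using that by (intro integrable_divide Bochner_Integration.integrable_sum D_int) auto
  have S_exp: "expectation (S \<omega>) = (\<Sum>i=1..N. \<Sum>j=1..N. expectation (D i j \<omega>)) / (real N)\<^sup>2"
    if "\<omega> \<in> space M" for \<omega>
  proof -
    have "expectation (\<lambda>\<omega>'. \<Sum>i=1..N. \<Sum>j=1..N. D i j \<omega> \<omega>')
        = (\<Sum>i=1..N. expectation (\<lambda>\<omega>'. \<Sum>j=1..N. D i j \<omega> \<omega>'))"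
      using that by (intro Bochner_Integration.integral_sum Bochner_Integration.integrable_sum D_int)
    also have "\<dots> = (\<Sum>i=1..N. \<Sum>j=1..N. expectation (D i j \<omega>))"
      using that by (intro sum.cong refl Bochner_Integration.integral_sum D_int)
    finally show ?thesis unfolding S_def by simp
  qed
  have S_int1: "integrable M (\<lambda>\<omega>. expectation (S \<omega>))"
    by (rule iffD2[OF Bochner_Integration.integrable_cong[OF refl S_exp]], assumption)
      (intro integrable_divide Bochner_Integration.integrable_sum D_int1)

  \<comment> \<open>With \<open>\<omega>\<close> fixed, \<open>X\<close> below is a function of the
    copy \<open>\<omega>'\<close> whose expectation is the quadrature error. Jensen's inequality and
    \<open>sum_eval_diff_sq_le\<close> bound the squared error by a quantity that does not depend on
    \<open>f\<close>, so the bound passes to the supremum.\<close>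
  have err_le: "(1 / real N * (\<Sum>n=1..N. f (Y n \<omega>)) - (LINT x:cbox 0 1|lborel. f x))\<^sup>2 \<le> expectation (S \<omega>)"
    if f: "f \<in> H" "sqrt (ip f f) \<le> 1" and \<omega>: "\<omega> \<in> space M" "\<forall>j\<in>{1..N}. Y j \<omega> \<in> cbox 0 1" for f \<omega>
  proof -
    have ip_le: "ip f f \<le> 1" using f(2) by simp
    note [measurable] = fm[OF f(1)]
    have f_bd: "\<bar>f x\<bar> \<le> 1" for x
    proof (cases "x \<in> cbox 0 1")
      case True
      \<comment> \<open>Both the squared norm of \<open>f\<close> and the diagonal of the kernel are
        at most 1.\<close>
      have "(f x)\<^sup>2 \<le> 1"
        using eval_sq_le[OF f(1) True] ip_le ip_nonneg[OF f(1)] box_kernel_bounds[OF True True]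
          mult_le_one[of "ip f f" "box_kernel x x"] by linarith
      then show ?thesis by (simp add: abs_square_le_1)
    qed (simp add: vanishes_outside[OF f(1)])
    have fY: "integrable M (\<lambda>\<omega>'. f (Y i \<omega>'))" if "i \<in> {1..N}" for i
      using Ym[OF that] f_bd by (intro integrable_const_bound[of _ 1]) auto
    define X where "X \<omega>' = 1 / real N * (\<Sum>i=1..N. f (Y i \<omega>) - f (Y i \<omega>'))" for \<omega>'
    have X_int: "integrable M X"
      unfolding X_def by (intro integrable_mult_right Bochner_Integration.integrable_sum Bochner_Integration.integrable_diff fY) auto
    have X_exp: "expectation X = 1 / real N * (\<Sum>n=1..N. f (Y n \<omega>)) - (LINT x:cbox 0 1|lborel. f x)"
    proof -
      have "expectation X = 1 / real N * (\<Sum>i=1..N. expectation (\<lambda>\<omega>'. f (Y i \<omega>) - f (Y i \<omega>')))"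
        unfolding X_def
        by (subst integral_mult_right_zero, subst Bochner_Integration.integral_sum)
          (auto intro!: Bochner_Integration.integrable_diff fY)
      also have "\<dots> = 1 / real N * (\<Sum>i=1..N. f (Y i \<omega>) - expectation (\<lambda>\<omega>'. f (Y i \<omega>')))"
        by (intro arg_cong2[where f = "(*)"] sum.cong refl) (simp add: fY prob_space)
      also have "\<dots> = 1 / real N * (\<Sum>n=1..N. f (Y n \<omega>)) - 1 / real N * (\<Sum>n=1..N. expectation (\<lambda>\<omega>'. f (Y n \<omega>')))"
        by (simp add: sum_subtractf diff_divide_distrib)
      also have "1 / real N * (\<Sum>n=1..N. expectation (\<lambda>\<omega>'. f (Y n \<omega>'))) = (LINT x:cbox 0 1|lborel. f x)"
        by (rule equal_measure_partition_integral[OF part N Y fm[OF f(1)] f_bd, symmetric])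
      finally show ?thesis .
    qed
    have X_le: "(X \<omega>')\<^sup>2 \<le> S \<omega> \<omega>'" if "\<forall>j\<in>{1..N}. Y j \<omega>' \<in> cbox 0 1" for \<omega>'
    proof -
      let ?T = "\<Sum>i=1..N. \<Sum>j=1..N. D i j \<omega> \<omega>'"
      have "?T = (\<Sum>i=1..N. \<Sum>j=1..N. box_kernel (Y i \<omega>) (Y j \<omega>) - box_kernel (Y i \<omega>) (Y j \<omega>')
          - box_kernel (Y i \<omega>') (Y j \<omega>) + box_kernel (Y i \<omega>') (Y j \<omega>'))"
        using that \<omega>(2) by (intro sum.cong refl) (simp add: D_def k_def)
      then have le: "(\<Sum>i=1..N. f (Y i \<omega>) - f (Y i \<omega>'))\<^sup>2 \<le> ip f f * ?T" and "0 \<le> ?T"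
        using sum_eval_diff_sq_le[OF f(1), of "{1..N}" "\<lambda>i. Y i \<omega>" "\<lambda>i. Y i \<omega>'"] that \<omega>(2) by simp_all
      then have "ip f f * ?T \<le> ?T"
        using mult_right_mono[OF ip_le \<open>0 \<le> ?T\<close>] by simp
      then show ?thesis
        using le by (simp add: X_def S_def power_mult_distrib power_divide divide_right_mono)
    qed
    have X_sq: "integrable M (\<lambda>\<omega>'. (X \<omega>')\<^sup>2)"
    proof (rule Bochner_Integration.integrable_bound[OF S_int[OF \<omega>(1)]])
      show "(\<lambda>\<omega>'. (X \<omega>')\<^sup>2) \<in> borel_measurable M"
        using X_int by measurable
      show "AE \<omega>' in M. norm ((X \<omega>')\<^sup>2) \<le> norm (S \<omega> \<omega>')"
        using AE_cube by eventually_elim (use X_le in force)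
    qed
    have "(expectation X)\<^sup>2 \<le> expectation (\<lambda>\<omega>'. (X \<omega>')\<^sup>2)"
      by (rule expectation_square_le[OF X_int X_sq])
    also have "\<dots> \<le> expectation (S \<omega>)"
      using AE_cube by (intro integral_mono_AE X_sq S_int \<omega>) (auto elim!: eventually_mono intro: X_le)
    finally show ?thesis unfolding X_exp .
  qed

  have "(\<integral>\<^sup>+\<omega>. sup_error \<omega> \<partial>M) \<le> (\<integral>\<^sup>+\<omega>. ennreal (expectation (S \<omega>)) \<partial>M)"
  proof (rule nn_integral_mono_AE)
    show "AE \<omega> in M. sup_error \<omega> \<le> ennreal (expectation (S \<omega>))"
      using AE_cube AE_space
    proof eventually_elim
      case (elim \<omega>)
      show ?case
        unfolding sup_error_def power2_abs
        by (intro SUP_least ennreal_leI err_le) (use elim in auto)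
    qed
  qed
  also have "\<dots> = ennreal (expectation (\<lambda>\<omega>. expectation (S \<omega>)))"
  proof (rule nn_integral_eq_integral[OF S_int1])
    show "AE \<omega> in M. 0 \<le> expectation (S \<omega>)"
      using AE_cube AE_space
    proof eventually_elim
      case (elim \<omega>)
      then show ?case
        \<comment> \<open>Nonnegativity is read off from \<open>err_le\<close> for the zero
          function, which lies in the unit ball.\<close>
        using order_trans[OF zero_le_power2 err_le[OF zero_mem]] ip_zero[OF zero_mem] by simp
    qed
  qed
  also have "expectation (\<lambda>\<omega>. expectation (S \<omega>))
      = (\<Sum>i=1..N. \<Sum>j=1..N. expectation (\<lambda>\<omega>. expectation (D i j \<omega>))) / (real N)\<^sup>2"
  proof -
    have "expectation (\<lambda>\<omega>. \<Sum>i=1..N. \<Sum>j=1..N. expectation (D i j \<omega>))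
        = (\<Sum>i=1..N. expectation (\<lambda>\<omega>. \<Sum>j=1..N. expectation (D i j \<omega>)))"
      by (intro Bochner_Integration.integral_sum Bochner_Integration.integrable_sum D_int1)
    also have "\<dots> = (\<Sum>i=1..N. \<Sum>j=1..N. expectation (\<lambda>\<omega>. expectation (D i j \<omega>)))"
      by (intro sum.cong refl Bochner_Integration.integral_sum D_int1)
    finally show ?thesis
      by (subst Bochner_Integration.integral_cong[OF refl S_exp]) simp_all
  qed
  also have "\<dots> = (\<Sum>i=1..N. \<Sum>j=1..N. if j = i then expectation (\<lambda>\<omega>. expectation (D i i \<omega>)) else 0) / (real N)\<^sup>2"
    using D_off by (intro arg_cong2[where f = "(/)"] sum.cong refl) auto
  also have "\<dots> = (\<Sum>i=1..N. expectation (\<lambda>\<omega>. expectation (D i i \<omega>))) / (real N)\<^sup>2"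
    by simp
  also have "ennreal \<dots> \<le> ennreal ((\<Sum>i=1..N. real CARD('n) * diam) / (real N)\<^sup>2)"
    by (intro ennreal_leI divide_right_mono sum_mono D_diag) auto
  \<comment> \<open>The \<open>N\<close> equal diagonal bounds divided by \<open>N\<close> squared
    leave one factor 1/N, which joins the power of \<open>N\<close> contained in
    \<open>diam\<close>.\<close>
  also have "(\<Sum>i=1..N. real CARD('n) * diam) / (real N)\<^sup>2 = real CARD('n) * c2 / real N powr (1 + 1 / real CARD('n))"
    using N by (simp add: diam_def powr_add powr_minus_divide power2_eq_square)
  finally show ?thesis
    using meas by (simp add: Let_def sup_error_def[abs_def])
qed

end
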